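(* Let $G$ be a countable group containing the free group $F_2$ on two generators as a subgroup. Then the set of actions of $G$ on $C(2^{\mathbb{N}})$ by positive linear isometries that do not admit an equivalent $G$-invariant strictly convex norm is comeager in $\mathrm{Act}^+_G(C(2^{\mathbb{N}}))$.
   Context: $2^{\mathbb{N}}$ is the Cantor space and $C(2^{\mathbb{N}})$ the real Banach lattice of continuous functions on it with the sup norm. $\mathrm{LIso}(C(2^{\mathbb{N}}))$ is the group of surjective positive linear isometries with the strong operator topology, and $\mathrm{Act}^+_G(C(2^{\mathbb{N}}))$ is the set of homomorphisms $G\to\mathrm{LIso}(C(2^{\mathbb{N}}))$, viewed as a closed subset of $\mathrm{LIso}(C(2^{\mathbb{N}}))^G$ with the product topology. A norm is $G$-invariant if each $g$ acts isometrically for it; strictly convex if for $f\neq h$ of equal norm, $\|\frac{f+h}{2}\|<\|f\|$. *)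

theory Defs
  imports "HOL-Analysis.Analysis" "HOL-Algebra.Group"
begin

text \<open>Cantor space is the type nat => bool with the product (Tychonoff) topology
  of the discrete space bool (library instances).  C(2^N) is the Banach lattice of
  (bounded = all, by compactness) continuous real functions with the sup norm.\<close>

type_synonym cantor = "nat \<Rightarrow> bool"
type_synonym CK = "(cantor \<Rightarrow>\<^sub>C real)"

definition positive_op :: "(CK \<Rightarrow> CK) \<Rightarrow> bool" where
  "positive_op T \<longleftrightarrow> (\<forall>f. (\<forall>x. 0 \<le> apply_bcontfun f x) \<longrightarrow> (\<forall>x. 0 \<le> apply_bcontfun (T f) x))"

definition LIso :: "(CK \<Rightarrow> CK) set" where
  "LIso = {T. linear T \<and> surj T \<and> positive_op T \<and> (\<forall>f. norm (T f) = norm f)}"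

definition SOT_LIso :: "(CK \<Rightarrow> CK) topology" where
  "SOT_LIso = subtopology (product_topology (\<lambda>_. euclidean) UNIV) LIso"

definition Act_set :: "('g, 'm) monoid_scheme \<Rightarrow> ('g \<Rightarrow> (CK \<Rightarrow> CK)) set" where
  "Act_set G = {\<rho>. \<rho> \<in> carrier G \<rightarrow>\<^sub>E LIso \<and>
      (\<forall>g\<in>carrier G. \<forall>h\<in>carrier G. \<rho> (g \<otimes>\<^bsub>G\<^esub> h) = \<rho> g \<circ> \<rho> h)}"

definition Act_top :: "('g, 'm) monoid_scheme \<Rightarrow> ('g \<Rightarrow> (CK \<Rightarrow> CK)) topology" where
  "Act_top G = subtopology (product_topology (\<lambda>_. SOT_LIso) (carrier G)) (Act_set G)"

definition nowhere_dense_in :: "'a topology \<Rightarrow> 'a set \<Rightarrow> bool" where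
  "nowhere_dense_in Y A \<longleftrightarrow> A \<subseteq> topspace Y \<and> Y interior_of (Y closure_of A) = {}"

definition meager_in :: "'a topology \<Rightarrow> 'a set \<Rightarrow> bool" where
  "meager_in Y A \<longleftrightarrow> (\<exists>N :: nat \<Rightarrow> 'a set. (\<forall>n. nowhere_dense_in Y (N n)) \<and> A = (\<Union>n. N n))"

definition comeager_in :: "'a topology \<Rightarrow> 'a set \<Rightarrow> bool" where
  "comeager_in Y A \<longleftrightarrow> A \<subseteq> topspace Y \<and> meager_in Y (topspace Y - A)"

definition is_norm_on_CK :: "(CK \<Rightarrow> real) \<Rightarrow> bool" where
  "is_norm_on_CK N \<longleftrightarrow> (\<forall>f. 0 \<le> N f) \<and> (\<forall>f. N f = 0 \<longleftrightarrow> f = 0) \<and>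
     (\<forall>c f. N (c *\<^sub>R f) = \<bar>c\<bar> * N f) \<and> (\<forall>f h. N (f + h) \<le> N f + N h)"

definition equivalent_norm :: "(CK \<Rightarrow> real) \<Rightarrow> bool" where
  "equivalent_norm N \<longleftrightarrow> is_norm_on_CK N \<and>
     (\<exists>c C. 0 < c \<and> 0 < C \<and> (\<forall>f. c * norm f \<le> N f \<and> N f \<le> C * norm f))"

definition strictly_convex_norm :: "(CK \<Rightarrow> real) \<Rightarrow> bool" where
  "strictly_convex_norm N \<longleftrightarrow>
     (\<forall>f h. f \<noteq> h \<and> N f = N h \<longrightarrow> N ((1/2) *\<^sub>R (f + h)) < N f)"

definition invariant_norm :: "('g, 'm) monoid_scheme \<Rightarrow> ('g \<Rightarrow> (CK \<Rightarrow> CK)) \<Rightarrow> (CK \<Rightarrow> real) \<Rightarrow> bool" where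
  "invariant_norm G \<rho> N \<longleftrightarrow> (\<forall>g\<in>carrier G. \<forall>f. N (\<rho> g f) = N f)"

text \<open>Free subgroup of rank 2: elements a, b such that no nonempty reduced word in
  a, b and their inverses evaluates to the identity (equivalently, the subgroup
  generated by a, b is free on {a, b}, i.e. isomorphic to F_2).
  A letter (x, s) means generator a if x, b otherwise, inverted if s.\<close>
definition letter_val :: "('g, 'm) monoid_scheme \<Rightarrow> 'g \<Rightarrow> 'g \<Rightarrow> bool \<times> bool \<Rightarrow> 'g" where
  "letter_val G a b l = (let y = (if fst l then a else b) in if snd l then inv\<^bsub>G\<^esub> y else y)"

definition word_val :: "('g, 'm) monoid_scheme \<Rightarrow> 'g \<Rightarrow> 'g \<Rightarrow> (bool \<times> bool) list \<Rightarrow> 'g" where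
  "word_val G a b w = foldr (\<lambda>l r. letter_val G a b l \<otimes>\<^bsub>G\<^esub> r) w \<one>\<^bsub>G\<^esub>"

definition reduced_word :: "(bool \<times> bool) list \<Rightarrow> bool" where
  "reduced_word w \<longleftrightarrow> (\<forall>i. Suc i < length w \<longrightarrow>
      \<not> (fst (w ! i) = fst (w ! Suc i) \<and> snd (w ! i) \<noteq> snd (w ! Suc i)))"

definition contains_free_group_2 :: "('g, 'm) monoid_scheme \<Rightarrow> bool" where
  "contains_free_group_2 G \<longleftrightarrow> (\<exists>a\<in>carrier G. \<exists>b\<in>carrier G.
     \<forall>w. w \<noteq> [] \<and> reduced_word w \<longrightarrow> word_val G a b w \<noteq> \<one>\<^bsub>G\<^esub>)"

end

theory Submission
  imports Defs
begin

text \<open>An invariant strictly convex norm cannot exist once there are \<open>f \<noteq> h\<close> and group elements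
  \<open>g\<close>, \<open>k\<close> with \<open>g f = h\<close> and \<open>k ((f + h) / 2) = f\<close>, because then \<open>f\<close>, \<open>h\<close> and their midpoint have
  the same norm. For finitely valued \<open>f\<close> and \<open>h\<close> this is an open condition on the action: positive
  isometries preserve 0/1-valued functions, and two such functions at distance less than 1 are equal.

  The condition is also dense. Two piecewise shifts of Cantor space produce such \<open>f\<close> and \<open>h\<close>;
  they define an action of the free group, which co-induces to an action of \<open>G\<close> on a countable
  power of Cantor space having the original one as a factor. The diagonal product of an arbitrary action
  with the co-induced one inherits the condition, and it converges to the given action when
  Cantor space is identified with its square by interleaving only the coordinates from \<open>n\<close> on
  and \<open>n\<close> tends to infinity.\<close>

section \<open>Cantor space\<close>

definition agree :: "nat \<Rightarrow> cantor \<Rightarrow> cantor \<Rightarrow> bool" where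
  "agree n x y \<longleftrightarrow> (\<forall>i<n. x i = y i)"

lemma agree_refl [simp]: "agree n x x"
  by (simp add: agree_def)

lemma agree_sym: "agree n x y \<Longrightarrow> agree n y x"
  by (simp add: agree_def)

lemma agree_trans: "agree n x y \<Longrightarrow> agree n y z \<Longrightarrow> agree n x z"
  by (simp add: agree_def)

lemma agree_mono: "agree n x y \<Longrightarrow> m \<le> n \<Longrightarrow> agree m x y"
  by (simp add: agree_def)

section \<open>Compactness, cylinders and uniform continuity\<close>

lemma compact_cantor: "compact (UNIV :: cantor set)"
proof -
  have "compact_space (euclidean :: bool topology)"
    using finite_imp_compact[of "UNIV :: bool set"]
    by (simp only: compact_space_def topspace_euclidean compactin_euclidean_iff) simp
  then have "compact_space (product_topology (\<lambda>i::nat. euclidean :: bool topology) UNIV)"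
    unfolding compact_space_product_topology by blast
  then show ?thesis
    unfolding euclidean_product_topology compact_space_def by simp
qed

lemma open_cylinder: "open {y. agree n x y}"
proof -
  have "{y. agree n x y} = (\<Inter>i\<in>{..<n}. (\<lambda>y. y i) -` {x i})"
    by (auto simp: agree_def)
  moreover have "open ((\<lambda>y::cantor. y i) -` {x i})" for i
    by (intro open_vimage continuous_on_product_coordinates open_discrete)
  ultimately show ?thesis
    by (simp add: open_INT)
qed

lemma cylinder_in_open:
  assumes "open (U :: cantor set)" "x \<in> U"
  obtains n where "{y. agree n x y} \<subseteq> U"
proof -
  have "openin (product_topology (\<lambda>i. euclidean) UNIV) U"
    using assms(1) unfolding open_fun_def .
  from product_topology_open_contains_basis[OF this assms(2)]
  obtain X where X: "x \<in> Pi\<^sub>E UNIV X" "finite {i. X i \<noteq> UNIV}" "Pi\<^sub>E UNIV X \<subseteq> U"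
    unfolding topspace_euclidean by blast
  obtain n where n: "\<forall>i\<in>{i. X i \<noteq> UNIV}. i < n"
    using X(2) unfolding finite_nat_set_iff_bounded by blast
  have "{y. agree n x y} \<subseteq> Pi\<^sub>E UNIV X"
  proof
    fix y assume y: "y \<in> {y. agree n x y}"
    have "y i \<in> X i" for i
    proof (cases "i < n")
      case True
      then have "y i = x i"
        using y by (simp add: agree_def)
      then show ?thesis
        using X(1) by (simp add: PiE_iff)
    next
      case False
      then have "X i = UNIV"
        using n by blast
      then show ?thesis
        by simp
    qed
    then show "y \<in> Pi\<^sub>E UNIV X"
      by (simp add: PiE_iff)
  qed
  then have "{y. agree n x y} \<subseteq> U"
    using X(3) by (rule subset_trans)
  then show thesis
    by (rule that)
qed

text \<open>Uniform continuity with respect to cylinders; by compactness this is continuity, in a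
  form that composes well with maps given by coordinates.\<close>

definition cylinder_continuous :: "(cantor \<Rightarrow> 'a::metric_space) \<Rightarrow> bool" where
  "cylinder_continuous F \<longleftrightarrow> (\<forall>e>0. \<exists>n. \<forall>x y. agree n x y \<longrightarrow> dist (F x) (F y) < e)"

text \<open>Around each point \<open>F\<close> varies by less than \<open>e/2\<close> on some
  cylinder. Finitely many of these cover the space, and the greatest of their lengths serves
  everywhere.\<close>

lemma cylinder_continuous_if_continuous:
  assumes "continuous_on UNIV F"
  shows "cylinder_continuous F"
  unfolding cylinder_continuous_def
proof (intro allI impI)
  fix e :: real assume "e > 0"
  have "\<exists>n. {y. agree n x y} \<subseteq> F -` ball (F x) (e/2)" for x
  proof -
    have "open (F -` ball (F x) (e/2))"
      using assms by (simp add: open_vimage)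
    then show ?thesis
      using cylinder_in_open[of "F -` ball (F x) (e/2)" x] \<open>e > 0\<close>
      by (meson centre_in_ball half_gt_zero vimageI2)
  qed
  then obtain k where k: "\<And>x. {y. agree (k x) x y} \<subseteq> F -` ball (F x) (e/2)"
    by metis
  have "UNIV \<subseteq> (\<Union>x. {y. agree (k x) x y})"
    using agree_refl by blast
  then obtain C where C: "finite C" "UNIV \<subseteq> (\<Union>x\<in>C. {y. agree (k x) x y})"
    by (rule compactE_image[OF compact_cantor open_cylinder])
  obtain n where n: "\<forall>m\<in>k ` C. m \<le> n"
    using finite_imageI[OF C(1), of k] unfolding finite_nat_set_iff_bounded_le by blast
  have "dist (F x) (F y) < e" if "agree n x y" for x y
  proof -
    obtain c where c: "c \<in> C" "agree (k c) c x"
      using C(2) by blast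
    have "agree (k c) x y"
      using that n c(1) by (auto intro: agree_mono)
    then have "agree (k c) c y"
      using c(2) agree_trans by blast
    then have "dist (F c) (F x) < e/2" "dist (F c) (F y) < e/2"
      using k[of c] c by auto
    then show ?thesis
      by (simp add: dist_triangle_half_r)
  qed
  then show "\<exists>n. \<forall>x y. agree n x y \<longrightarrow> dist (F x) (F y) < e"
    by blast
qed

lemma continuous_if_cylinder_continuous:
  assumes "cylinder_continuous F"
  shows "continuous_on UNIV F"
proof (clarsimp simp: continuous_on_def intro!: tendstoI)
  fix x and e :: real assume "e > 0"
  then obtain n where n: "\<And>x y. agree n x y \<Longrightarrow> dist (F x) (F y) < e"
    using assms unfolding cylinder_continuous_def by blast
  have "\<forall>\<^sub>F y in at x. y \<in> {y. agree n x y}"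
    using open_cylinder by (rule eventually_at_in_open') simp
  then show "\<forall>\<^sub>F y in at x. dist (F y) (F x) < e"
    by eventually_elim (auto intro: n agree_sym)
qed

lemma apply_Bcontfun_cylinder_continuous:
  fixes F :: "cantor \<Rightarrow> real"
  assumes "cylinder_continuous F"
  shows "apply_bcontfun (Bcontfun F) = F"
proof -
  have "continuous_on UNIV F"
    by (rule continuous_if_cylinder_continuous) fact
  moreover have "bounded (range F)"
    by (rule compact_imp_bounded compact_continuous_image compact_cantor calculation)+
  ultimately show ?thesis
    by (simp add: Bcontfun_inverse bcontfun_def)
qed

lemma cylinder_continuous_apply_bcontfun: "cylinder_continuous (apply_bcontfun f)"
  by (rule cylinder_continuous_if_continuous) simp

lemma CK_norm_leI:
  fixes f :: CK
  assumes "\<And>x. \<bar>f x\<bar> \<le> b"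
  shows "norm f \<le> b"
  using norm_bound[of f b] assms by simp

lemma CK_abs_le_norm: "\<bar>apply_bcontfun (f :: CK) x\<bar> \<le> norm f"
  using norm_bounded[of f x] by simp

text \<open>Continuity of a self-map of Cantor space, expressed by coordinates.\<close>

definition finitary :: "(cantor \<Rightarrow> cantor) \<Rightarrow> bool" where
  "finitary \<phi> \<longleftrightarrow> (\<forall>i. \<exists>n. \<forall>x y. agree n x y \<longrightarrow> \<phi> x i = \<phi> y i)"

lemma finitary_agree:
  assumes "finitary \<phi>"
  shows "\<exists>n. \<forall>x y. agree n x y \<longrightarrow> agree m (\<phi> x) (\<phi> y)"
proof (induction m)
  case 0
  show ?case by (simp add: agree_def)
next
  case (Suc m)
  then obtain n where n: "\<And>x y. agree n x y \<Longrightarrow> agree m (\<phi> x) (\<phi> y)"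
    by blast
  obtain k where k: "\<And>x y. agree k x y \<Longrightarrow> \<phi> x m = \<phi> y m"
    using assms unfolding finitary_def by blast
  have "agree (Suc m) (\<phi> x) (\<phi> y)" if "agree (max n k) x y" for x y
    using n[OF agree_mono[OF that]] k[OF agree_mono[OF that]]
    by (auto simp: agree_def less_Suc_eq)
  then show ?case by blast
qed

lemma finitary_id: "finitary (\<lambda>x. x)"
  unfolding finitary_def agree_def by blast

lemma finitary_comp:
  assumes "finitary \<phi>" "finitary \<psi>"
  shows "finitary (\<lambda>x. \<phi> (\<psi> x))"
  unfolding finitary_def
proof
  fix i
  obtain m where m: "\<And>x y. agree m x y \<Longrightarrow> \<phi> x i = \<phi> y i"
    using assms(1) unfolding finitary_def by blast
  obtain n where "\<And>x y. agree n x y \<Longrightarrow> agree m (\<psi> x) (\<psi> y)"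
    using finitary_agree[OF assms(2)] by blast
  then show "\<exists>n. \<forall>x y. agree n x y \<longrightarrow> \<phi> (\<psi> x) i = \<phi> (\<psi> y) i"
    using m by blast
qed

lemma cylinder_continuous_comp:
  assumes "cylinder_continuous F" "finitary \<phi>"
  shows "cylinder_continuous (\<lambda>x. F (\<phi> x))"
  unfolding cylinder_continuous_def
proof (intro allI impI)
  fix e :: real assume "e > 0"
  then obtain m where m: "\<And>x y. agree m x y \<Longrightarrow> dist (F x) (F y) < e"
    using assms(1) unfolding cylinder_continuous_def by blast
  obtain n where "\<And>x y. agree n x y \<Longrightarrow> agree m (\<phi> x) (\<phi> y)"
    using finitary_agree[OF assms(2)] by blast
  then show "\<exists>n. \<forall>x y. agree n x y \<longrightarrow> dist (F (\<phi> x)) (F (\<phi> y)) < e"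
    using m by blast
qed

section \<open>Cantor space as its own square\<close>

text \<open>The homeomorphism \<open>(cfst n, csnd n)\<close> of Cantor space with its square interleaves
  only the coordinates from \<open>n\<close> on, so that \<open>cfst n\<close> tends uniformly to the identity.\<close>

definition cpair :: "nat \<Rightarrow> cantor \<Rightarrow> cantor \<Rightarrow> cantor" where
  "cpair n x y = (\<lambda>m. if m < n then x m
     else if even (m - n) then x (n + (m - n) div 2) else y ((m - n) div 2))"

definition cfst :: "nat \<Rightarrow> cantor \<Rightarrow> cantor" where
  "cfst n z = (\<lambda>i. if i < n then z i else z (n + 2 * (i - n)))"

definition csnd :: "nat \<Rightarrow> cantor \<Rightarrow> cantor" where
  "csnd n z = (\<lambda>i. z (n + 2 * i + 1))"

lemma cfst_cpair [simp]: "cfst n (cpair n x y) = x"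
  by (auto simp: cfst_def cpair_def fun_eq_iff)

lemma csnd_cpair [simp]: "csnd n (cpair n x y) = y"
  by (auto simp: csnd_def cpair_def fun_eq_iff)

lemma cpair_cfst_csnd [simp]: "cpair n (cfst n z) (csnd n z) = z"
proof
  fix m
  show "cpair n (cfst n z) (csnd n z) m = z m"
  proof (cases "m < n")
    case False
    then obtain k where "m = n + k"
      using le_Suc_ex not_less by blast
    then show ?thesis
      by (auto simp: cpair_def cfst_def csnd_def elim: oddE)
  qed (simp add: cpair_def cfst_def)
qed

lemma agree_cpair:
  "agree m x x' \<Longrightarrow> agree m y y' \<Longrightarrow> agree m (cpair n x y) (cpair n x' y')"
  by (auto simp: agree_def cpair_def)

lemma finitary_cfst: "finitary (cfst n)"
  unfolding finitary_def agree_def cfst_def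
  by (metis add_less_cancel_left lessI less_imp_add_positive trans_less_add1 less_Suc_eq)

lemma finitary_csnd: "finitary (csnd n)"
  unfolding finitary_def agree_def csnd_def by blast

lemma finitary_cpair_left: "finitary (\<lambda>x. cpair n x y)"
  unfolding finitary_def
proof
  fix i
  show "\<exists>m. \<forall>x x'. agree m x x' \<longrightarrow> cpair n x y i = cpair n x' y i"
    using agree_cpair[of "Suc i" _ _ y y n] by (auto simp: agree_def intro!: exI[of _ "Suc i"])
qed

lemma agree_cfst: "agree n (cfst n z) z"
  by (simp add: agree_def cfst_def)

lemma agree_cpair_left: "agree n (cpair n x y) x"
  by (simp add: agree_def cpair_def)

section \<open>Positive isometries and their actions\<close>

lemma LIsoD:
  assumes "T \<in> LIso"
  shows "linear T" "surj T" "norm (T f) = norm f"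
    "(\<And>x. 0 \<le> apply_bcontfun f x) \<Longrightarrow> 0 \<le> apply_bcontfun (T f) x"
  using assms by (auto simp: LIso_def positive_op_def)

lemma LIso_mono:
  assumes "T \<in> LIso" "\<And>x. apply_bcontfun f x \<le> apply_bcontfun h x"
  shows "apply_bcontfun (T f) x \<le> apply_bcontfun (T h) x"
  using LIsoD(4)[OF assms(1), of "h - f" x] assms(2) LIsoD(1)[OF assms(1)]
  by (simp add: linear_diff)

text \<open>The constant 1 is the greatest element of the unit ball. Its preimage \<open>u\<close>
  has norm at most 1, so \<open>u \<le> 1\<close> and hence
  \<open>1 = T u \<le> T 1 \<le> 1\<close>.\<close>

lemma LIso_const:
  assumes "T \<in> LIso"
  shows "T (const_bcontfun c) = const_bcontfun c"
proof -
  let ?e = "const_bcontfun 1 :: CK"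
  have norm_e: "norm ?e \<le> 1"
    by (rule CK_norm_leI) (simp add: const_bcontfun.rep_eq)
  obtain u where u: "T u = ?e"
    using LIsoD(2)[OF assms] by (metis surjD)
  have "apply_bcontfun u x \<le> apply_bcontfun ?e x" for x
    using CK_abs_le_norm[of u x] norm_e LIsoD(3)[OF assms, of u] u
    by (simp add: const_bcontfun.rep_eq)
  then have "apply_bcontfun (T u) x \<le> apply_bcontfun (T ?e) x" for x
    by (rule LIso_mono[OF assms])
  moreover have "apply_bcontfun (T ?e) x \<le> 1" for x
    using CK_abs_le_norm[of "T ?e" x] norm_e LIsoD(3)[OF assms, of ?e] by simp
  ultimately have "T ?e = ?e"
    unfolding u by (intro bcontfun_eqI antisym) (simp_all add: const_bcontfun.rep_eq)
  moreover have "const_bcontfun c = c *\<^sub>R ?e"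
    by (rule bcontfun_eqI) (simp add: const_bcontfun.rep_eq)
  ultimately show ?thesis
    using LIsoD(1)[OF assms] by (simp add: linear_scale)
qed

definition zero_one :: "CK \<Rightarrow> bool" where
  "zero_one p \<longleftrightarrow> (\<forall>x. apply_bcontfun p x = 0 \<or> apply_bcontfun p x = 1)"

text \<open>A 0/1-valued function \<open>p\<close> is one for which \<open>p\<close> and \<open>1 - p\<close> have infimum 0, a
  property preserved by order isomorphisms.\<close>

lemma LIso_zero_one:
  assumes T: "T \<in> LIso" and S: "S \<in> LIso" and inverse: "\<And>f. S (T f) = f" "\<And>f. T (S f) = f"
    and p: "zero_one p"
  shows "zero_one (T p)"
proof -
  let ?e = "const_bcontfun 1 :: CK"
  \<comment> \<open>The infimum of \<open>T p\<close> and \<open>1 - T p\<close>; its image under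
    \<open>S\<close> lies between 0 and the infimum of \<open>p\<close> and \<open>1 - p\<close>,
    which is 0.\<close>
  define q :: CK where "q = Bcontfun (\<lambda>x. min (T p x) (1 - T p x))"
  have q: "apply_bcontfun q x = min (T p x) (1 - T p x)" for x
    unfolding q_def by (subst apply_Bcontfun_cylinder_continuous)
      (auto intro!: cylinder_continuous_if_continuous continuous_intros)
  have ST: "S (?e - T p) = ?e - p"
    using LIsoD(1)[OF S] inverse by (simp add: linear_diff LIso_const[OF S])
  have p01: "0 \<le> apply_bcontfun p x" "apply_bcontfun p x \<le> apply_bcontfun ?e x" for x
    using p[unfolded zero_one_def, rule_format, of x] by (auto simp: const_bcontfun.rep_eq)
  have Tp01: "0 \<le> T p x" "T p x \<le> 1" for x
    using LIsoD(4)[OF T p01(1)] LIso_mono[OF T p01(2)]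
    by (auto simp: LIso_const[OF T] const_bcontfun.rep_eq)
  have "apply_bcontfun (S q) x = 0" for x
  proof -
    have "S q x \<le> S (T p) x"
      by (rule LIso_mono[OF S]) (simp add: q)
    moreover have "S q x \<le> S (?e - T p) x"
      by (rule LIso_mono[OF S]) (simp add: q const_bcontfun.rep_eq)
    moreover have "0 \<le> S q x"
      by (rule LIsoD(4)[OF S]) (simp add: q Tp01)
    ultimately show ?thesis
      using p[unfolded zero_one_def, rule_format, of x]
      by (auto simp: inverse ST const_bcontfun.rep_eq)
  qed
  then have "S q = 0"
    by (intro bcontfun_eqI) simp
  then have "q = 0"
    using inverse(2)[of q] LIsoD(1)[OF T] by (simp add: linear_0)
  then have "T p x = 0 \<or> T p x = 1" for x
    using q[of x] by (simp add: min_def split: if_splits)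
  then show ?thesis
    unfolding zero_one_def by blast
qed

lemma zero_one_eq_if_close:
  assumes "zero_one p" "zero_one q" "norm (p - q) < 1"
  shows "p = q"
proof (rule bcontfun_eqI)
  fix x
  show "apply_bcontfun p x = apply_bcontfun q x"
    using assms(1,2)[unfolded zero_one_def, rule_format, of x] CK_abs_le_norm[of "p - q" x] assms(3)
    by auto
qed

context
  fixes G :: "('g, 'm) monoid_scheme" (structure) and \<rho>
  assumes G: "group G" and \<rho>: "\<rho> \<in> Act_set G"
begin

interpretation group G by (rule G)

lemma Act_set_LIso: "g \<in> carrier G \<Longrightarrow> \<rho> g \<in> LIso"
  using \<rho> by (auto simp: Act_set_def)

lemma Act_set_mult: "g \<in> carrier G \<Longrightarrow> h \<in> carrier G \<Longrightarrow> \<rho> (g \<otimes> h) f = \<rho> g (\<rho> h f)"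
  using \<rho> by (auto simp: Act_set_def)

text \<open>Only multiplicativity is built into \<open>Act_set\<close>; \<open>\<rho> \<one>\<close>
  is idempotent and surjective, hence the identity.\<close>

lemma Act_set_one: "\<rho> \<one> f = f"
proof -
  obtain h where "f = \<rho> \<one> h"
    using LIsoD(2)[OF Act_set_LIso[OF one_closed]] by (metis surjD)
  then show ?thesis
    using Act_set_mult[of \<one> \<one> h] by simp
qed

lemma Act_set_zero_one:
  assumes "g \<in> carrier G" "zero_one p"
  shows "zero_one (\<rho> g p)"
proof (rule LIso_zero_one[of "\<rho> g" "\<rho> (inv g)"])
  show "\<rho> g \<in> LIso" "\<rho> (inv g) \<in> LIso"
    using assms Act_set_LIso by auto
  show "\<rho> (inv g) (\<rho> g f) = f" "\<rho> g (\<rho> (inv g) f) = f" for f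
    using assms by (simp_all add: Act_set_one flip: Act_set_mult)
qed fact

end

section \<open>Twisted products\<close>

text \<open>The twisted product of an operator \<open>T\<close> with a self-map of the second factor of
  Cantor space squared: \<open>T\<close> is applied to the slices of a function. For \<open>T f = f \<circ> \<alpha>\<close>
  this is composition with \<open>\<alpha> \<times> \<phi>\<close>, but no such representation of \<open>T\<close> is required.\<close>

definition slice :: "nat \<Rightarrow> CK \<Rightarrow> cantor \<Rightarrow> CK" where
  "slice n f y = Bcontfun (\<lambda>x. f (cpair n x y))"

definition twist :: "nat \<Rightarrow> (CK \<Rightarrow> CK) \<Rightarrow> (cantor \<Rightarrow> cantor) \<Rightarrow> CK \<Rightarrow> CK" where
  "twist n T \<phi> f = Bcontfun (\<lambda>z. T (slice n f (\<phi> (csnd n z))) (cfst n z))"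

lemma slice_apply: "apply_bcontfun (slice n f y) x = f (cpair n x y)"
  unfolding slice_def
  by (subst apply_Bcontfun_cylinder_continuous)
    (rule cylinder_continuous_comp[OF cylinder_continuous_apply_bcontfun finitary_cpair_left] refl)+

lemma cylinder_continuous_slice: "cylinder_continuous (slice n f)"
  unfolding cylinder_continuous_def
proof (intro allI impI)
  fix e :: real assume "e > 0"
  then obtain m where m: "\<And>x y. agree m x y \<Longrightarrow> dist (f x) (f y) < e/2"
    using cylinder_continuous_apply_bcontfun[of f] unfolding cylinder_continuous_def
    by (meson half_gt_zero)
  have "dist (slice n f y) (slice n f y') < e" if "agree m y y'" for y y'
  proof -
    have "dist (slice n f y) (slice n f y') \<le> e/2"
      using that by (intro dist_bound, unfold slice_apply) (intro less_imp_le[OF m] agree_cpair agree_refl)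
    then show ?thesis
      using \<open>e > 0\<close> by simp
  qed
  then show "\<exists>m. \<forall>y y'. agree m y y' \<longrightarrow> dist (slice n f y) (slice n f y') < e"
    by blast
qed

text \<open>\<open>Bcontfun\<close> is meaningful only on bounded continuous functions, so the
  defining formula must be shown continuous.\<close>

lemma twist_apply:
  assumes T: "T \<in> LIso" and "finitary \<phi>"
  shows "apply_bcontfun (twist n T \<phi> f) z = T (slice n f (\<phi> (csnd n z))) (cfst n z)"
proof -
  let ?s = "\<lambda>z. slice n f (\<phi> (csnd n z))"
  have s: "continuous_on UNIV ?s"
    by (rule continuous_if_cylinder_continuous
        cylinder_continuous_comp[OF cylinder_continuous_slice finitary_comp[OF assms(2) finitary_csnd]])+
  have dist: "dist (T f) (T h) = dist f h" for f h
    using LIsoD(1)[OF T] LIsoD(3)[OF T] by (simp add: dist_norm flip: linear_diff)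
  have "continuous_on UNIV (\<lambda>z. T (?s z) (cfst n z))"
  proof (clarsimp simp: continuous_on_def intro!: tendstoI)
    fix z and e :: real assume "e > 0"
    have "continuous_on UNIV (\<lambda>z'. T (?s z) (cfst n z'))"
      by (rule continuous_if_cylinder_continuous
          cylinder_continuous_comp[OF cylinder_continuous_apply_bcontfun finitary_cfst])+
    then have "\<forall>\<^sub>F z' in at z. dist (T (?s z) (cfst n z')) (T (?s z) (cfst n z)) < e/2"
      using \<open>e > 0\<close> by (intro tendstoD) (simp_all add: continuous_on_def)
    moreover have "\<forall>\<^sub>F z' in at z. dist (?s z') (?s z) < e/2"
      using s \<open>e > 0\<close> by (intro tendstoD) (simp_all add: continuous_on_def)
    \<comment> \<open>First the slice changes at the fixed point \<open>cfst n z'\<close>, at no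
      more cost than the distance of the slices since \<open>T\<close> is isometric; then the point
      moves while the slice stays fixed.\<close>
    ultimately show "\<forall>\<^sub>F z' in at z. dist (T (?s z') (cfst n z')) (T (?s z) (cfst n z)) < e"
    proof eventually_elim
      case (elim z')
      have "dist (T (?s z') (cfst n z')) (T (?s z) (cfst n z')) < e/2"
        by (rule dist_fun_lt_imp_dist_val_lt) (use elim in \<open>simp add: dist\<close>)
      then show ?case
        using elim(1) unfolding dist_real_def by linarith
    qed
  qed
  then have "cylinder_continuous (\<lambda>z. T (?s z) (cfst n z))"
    by (rule cylinder_continuous_if_continuous)
  then show ?thesis
    unfolding twist_def by (simp add: apply_Bcontfun_cylinder_continuous)
qed

lemma slice_twist:
  assumes "T \<in> LIso" "finitary \<phi>"
  shows "slice n (twist n T \<phi> f) y = T (slice n f (\<phi> y))"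
  by (rule bcontfun_eqI) (simp add: slice_apply twist_apply[OF assms])

lemma norm_twist_le:
  assumes "T \<in> LIso" "finitary \<phi>"
  shows "norm (twist n T \<phi> f) \<le> norm f"
proof (rule CK_norm_leI)
  fix z
  have "\<bar>twist n T \<phi> f z\<bar> \<le> norm (T (slice n f (\<phi> (csnd n z))))"
    unfolding twist_apply[OF assms] by (rule CK_abs_le_norm)
  also have "\<dots> = norm (slice n f (\<phi> (csnd n z)))"
    by (rule LIsoD(3)[OF assms(1)])
  also have "\<dots> \<le> norm f"
    by (rule CK_norm_leI) (simp add: slice_apply CK_abs_le_norm)
  finally show "\<bar>twist n T \<phi> f z\<bar> \<le> norm f" .
qed

lemma linear_twist:
  assumes "T \<in> LIso" "finitary \<phi>"
  shows "linear (twist n T \<phi>)"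
proof (rule linearI)
  have [simp]: "slice n (f + h) y = slice n f y + slice n h y"
    "slice n (c *\<^sub>R f) y = c *\<^sub>R slice n f y" for f h y c
    by (rule bcontfun_eqI, simp add: slice_apply)+
  note lin = LIsoD(1)[OF assms(1)]
  show "twist n T \<phi> (f + h) = twist n T \<phi> f + twist n T \<phi> h" for f h
    by (rule bcontfun_eqI) (simp add: twist_apply[OF assms] linear_add[OF lin])
  show "twist n T \<phi> (c *\<^sub>R f) = c *\<^sub>R twist n T \<phi> f" for c f
    by (rule bcontfun_eqI) (simp add: twist_apply[OF assms] linear_scale[OF lin])
qed

text \<open>A function of the second factor alone has constant slices, and \<open>T\<close> fixes
  constants. So the twist acts on such functions through \<open>\<phi>\<close> only, whatever
  \<open>T\<close> is.\<close>

lemma twist_comp_csnd: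
  assumes T: "T \<in> LIso" and \<phi>: "finitary \<phi>" and F: "cylinder_continuous F"
  shows "twist n T \<phi> (Bcontfun (\<lambda>z. F (csnd n z))) = Bcontfun (\<lambda>z. F (\<phi> (csnd n z)))"
proof (rule bcontfun_eqI)
  fix z
  have B: "apply_bcontfun (Bcontfun (\<lambda>z. F (\<psi> (csnd n z)))) = (\<lambda>z. F (\<psi> (csnd n z)))"
    if "finitary \<psi>" for \<psi>
    by (rule apply_Bcontfun_cylinder_continuous)
      (rule cylinder_continuous_comp[OF F finitary_comp[OF that finitary_csnd]])
  have "slice n (Bcontfun (\<lambda>z. F (csnd n z))) y = const_bcontfun (F y)" for y
    using B[OF finitary_id] by (intro bcontfun_eqI) (simp add: slice_apply const_bcontfun.rep_eq)
  then show "twist n T \<phi> (Bcontfun (\<lambda>z. F (csnd n z))) z = Bcontfun (\<lambda>z. F (\<phi> (csnd n z))) z"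
    by (simp add: twist_apply[OF T \<phi>] LIso_const[OF T] const_bcontfun.rep_eq B[OF \<phi>])
qed

text \<open>For large \<open>n\<close>, \<open>cpair n x y\<close> is close to \<open>x\<close> and
  \<open>cfst n z\<close> to \<open>z\<close>, so the slices are uniformly close to \<open>f\<close>
  and the evaluation point hardly moves.\<close>

lemma twist_tendsto:
  assumes T: "T \<in> LIso" and \<phi>: "finitary \<phi>"
  shows "(\<lambda>n. twist n T \<phi> f) \<longlonglongrightarrow> T f"
proof (rule LIMSEQ_I)
  fix e :: real assume "e > 0"
  have approx: "\<exists>m. \<forall>x y. agree m x y \<longrightarrow> dist (apply_bcontfun h x) (h y) < e/3" for h :: CK
    using cylinder_continuous_apply_bcontfun[of h, unfolded cylinder_continuous_def, rule_format, of "e/3"]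
      \<open>e > 0\<close> by simp
  obtain k where k: "\<And>x y. agree k x y \<Longrightarrow> dist (f x) (f y) < e/3"
    using approx[of f] by blast
  obtain l where l: "\<And>x y. agree l x y \<Longrightarrow> dist (T f x) (T f y) < e/3"
    using approx[of "T f"] by blast
  have "norm (twist n T \<phi> f - T f) < e" if n: "n \<ge> max k l" for n
  proof -
    have "\<bar>(twist n T \<phi> f - T f) z\<bar> \<le> 2 * e / 3" for z
    proof -
      let ?s = "slice n f (\<phi> (csnd n z))"
      have "\<bar>T ?s (cfst n z) - T f (cfst n z)\<bar> \<le> norm (T ?s - T f)"
        using CK_abs_le_norm[of "T ?s - T f" "cfst n z"] by simp
      also have "\<dots> = norm (?s - f)"
        using LIsoD(1)[OF T] LIsoD(3)[OF T] by (simp flip: linear_diff)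
      also have "\<dots> \<le> e/3"
      proof (rule CK_norm_leI)
        fix x
        have "agree k (cpair n x (\<phi> (csnd n z))) x"
          using agree_cpair_left by (rule agree_mono) (use n in simp)
        from k[OF this] show "\<bar>(?s - f) x\<bar> \<le> e/3"
          by (simp add: slice_apply dist_real_def)
      qed
      finally have "\<bar>T ?s (cfst n z) - T f (cfst n z)\<bar> \<le> e/3" .
      moreover have "agree l (cfst n z) z"
        using agree_cfst by (rule agree_mono) (use n in simp)
      from l[OF this] have "\<bar>T f (cfst n z) - T f z\<bar> < e/3"
        by (simp add: dist_real_def)
      ultimately show ?thesis
        unfolding minus_bcontfun.rep_eq twist_apply[OF T \<phi>] by linarith
    qed
    then have "norm (twist n T \<phi> f - T f) \<le> 2 * e / 3"
      by (rule CK_norm_leI)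
    then show ?thesis
      using \<open>e > 0\<close> by simp
  qed
  then show "\<exists>m. \<forall>n\<ge>m. norm (twist n T \<phi> f - T f) < e"
    by blast
qed

definition twist_action ::
  "('g, 'm) monoid_scheme \<Rightarrow> nat \<Rightarrow> ('g \<Rightarrow> CK \<Rightarrow> CK) \<Rightarrow> ('g \<Rightarrow> cantor \<Rightarrow> cantor) \<Rightarrow> 'g \<Rightarrow> CK \<Rightarrow> CK" where
  "twist_action G n \<rho> R = (\<lambda>g\<in>carrier G. twist n (\<rho> g) (R g))"

text \<open>A right action, because composition reverses the order:
  \<open>f \<mapsto> f \<circ> R g\<close> is then a homomorphism in \<open>g\<close>.\<close>

locale right_action = group G for G :: "('g, 'm) monoid_scheme" (structure) +
  fixes R :: "'g \<Rightarrow> cantor \<Rightarrow> cantor"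
  assumes R_finitary: "g \<in> carrier G \<Longrightarrow> finitary (R g)"
    and R_one: "R \<one> y = y"
    and R_mult: "g \<in> carrier G \<Longrightarrow> h \<in> carrier G \<Longrightarrow> R (g \<otimes> h) y = R h (R g y)"
begin

lemma twist_action_in_Act_set:
  assumes \<rho>: "\<rho> \<in> Act_set G"
  shows "twist_action G n \<rho> R \<in> Act_set G"
proof -
  let ?t = "\<lambda>g. twist n (\<rho> g) (R g)"
  note LI = Act_set_LIso[OF group_axioms \<rho>]
  have mult: "?t (g \<otimes> h) = ?t g \<circ> ?t h" if gh: "g \<in> carrier G" "h \<in> carrier G" for g h
  proof (intro ext bcontfun_eqI)
    fix f z
    show "?t (g \<otimes> h) f z = (?t g \<circ> ?t h) f z"
      using gh by (simp add: twist_apply LI R_finitary slice_twist R_mult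
          Act_set_mult[OF group_axioms \<rho>])
  qed
  have one: "?t \<one> f = f" for f
    by (rule bcontfun_eqI)
      (simp add: twist_apply LI R_finitary R_one Act_set_one[OF group_axioms \<rho>] slice_apply)
  have "?t g \<in> LIso" if g: "g \<in> carrier G" for g
  proof -
    have inv1: "?t (inv g) (?t g f) = f" and inv2: "?t g (?t (inv g) f) = f" for f
      using mult[of "inv g" g] mult[of g "inv g"] g one[of f] by (simp_all add: fun_eq_iff)
    \<comment> \<open>\<open>?t g\<close> and its inverse \<open>?t (inv g)\<close> are both
      contractions, hence isometries.\<close>
    have "norm f \<le> norm (?t g f)" for f
      using norm_twist_le[of "\<rho> (inv g)" "R (inv g)" n "?t g f"] g
      by (simp add: LI R_finitary inv1)
    then have "norm (?t g f) = norm f" for f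
      using norm_twist_le[OF LI[OF g] R_finitary[OF g]] antisym by blast
    moreover have "surj (?t g)"
      using inv2 by (metis surjI)
    moreover have "positive_op (?t g)"
      unfolding positive_op_def
    proof (intro allI impI)
      fix f :: CK and z assume f: "\<forall>x. 0 \<le> apply_bcontfun f x"
      show "0 \<le> ?t g f z"
        unfolding twist_apply[OF LI[OF g] R_finitary[OF g]]
        by (rule LIsoD(4)[OF LI[OF g]]) (simp add: slice_apply f)
    qed
    ultimately show ?thesis
      using linear_twist[OF LI[OF g] R_finitary[OF g]] by (simp add: LIso_def)
  qed
  then show ?thesis
    using mult by (auto simp: Act_set_def twist_action_def)
qed

lemma twist_action_limitin:
  assumes \<rho>: "\<rho> \<in> Act_set G"
  shows "limitin (Act_top G) (\<lambda>n. twist_action G n \<rho> R) \<rho> sequentially"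
proof -
  have top: "topspace (product_topology (\<lambda>_. SOT_LIso) (carrier G)) = carrier G \<rightarrow>\<^sub>E LIso"
    by (simp add: SOT_LIso_def)
  have ext: "\<sigma> \<in> carrier G \<rightarrow>\<^sub>E LIso" if "\<sigma> \<in> Act_set G" for \<sigma>
    using that by (simp add: Act_set_def)
  have "limitin SOT_LIso (\<lambda>n. twist_action G n \<rho> R g) (\<rho> g) sequentially" if g: "g \<in> carrier G" for g
  proof -
    have LI: "\<rho> g \<in> LIso" "twist n (\<rho> g) (R g) \<in> LIso" for n
      using ext[OF \<rho>] ext[OF twist_action_in_Act_set[OF \<rho>, of n]] g
      by (auto simp: PiE_iff twist_action_def)
    have "limitin (product_topology (\<lambda>_. euclidean) UNIV) (\<lambda>n. twist n (\<rho> g) (R g)) (\<rho> g) sequentially"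
      unfolding limitin_componentwise using twist_tendsto[OF LI(1) R_finitary[OF g]] by simp
    then show ?thesis
      using LI g by (simp add: SOT_LIso_def limitin_subtopology twist_action_def)
  qed
  then show ?thesis
    unfolding Act_top_def limitin_subtopology limitin_componentwise top
    using \<rho> twist_action_in_Act_set ext by (auto simp: PiE_iff)
qed

end

section \<open>Co-induced actions\<close>

text \<open>\<open>L\<close> gives each letter a homeomorphism, inverse letters getting inverse
  maps. This is the action of the free group on \<open>a\<close> and \<open>b\<close> that is to be
  co-induced.\<close>

locale free_pair = group G for G :: "('g, 'm) monoid_scheme" (structure) +
  fixes a b :: 'g and L :: "bool \<times> bool \<Rightarrow> cantor \<Rightarrow> cantor"
  assumes countable_G: "countable (carrier G)"
    and a [simp]: "a \<in> carrier G" and b [simp]: "b \<in> carrier G"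
    and free: "w \<noteq> [] \<Longrightarrow> reduced_word w \<Longrightarrow> word_val G a b w \<noteq> \<one>"
    and L_finitary: "finitary (L l)"
    and L_inverse: "L (x, \<not> s) (L (x, s) y) = y"
begin

section \<open>Words and their action\<close>

abbreviation val :: "(bool \<times> bool) list \<Rightarrow> 'g" where "val \<equiv> word_val G a b"

text \<open>\<open>fold\<close> applies the first letter first, so words act from the right.\<close>

definition act :: "(bool \<times> bool) list \<Rightarrow> cantor \<Rightarrow> cantor" where "act = fold L"

definition flip :: "bool \<times> bool \<Rightarrow> bool \<times> bool" where "flip l = (fst l, \<not> snd l)"

definition winv :: "(bool \<times> bool) list \<Rightarrow> (bool \<times> bool) list" where "winv w = rev (map flip w)"

lemma letter_closed [simp]: "letter_val G a b l \<in> carrier G"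
  by (simp add: letter_val_def Let_def)

lemma val_closed [simp]: "val w \<in> carrier G"
  by (induction w) (simp_all add: word_val_def)

lemma val_Nil [simp]: "val [] = \<one>"
  by (simp add: word_val_def)

lemma val_Cons: "val (l # w) = letter_val G a b l \<otimes> val w"
  by (simp add: word_val_def)

lemma val_append: "val (u @ w) = val u \<otimes> val w"
  by (induction u) (simp_all add: val_Cons m_assoc)

lemma letter_flip: "letter_val G a b (flip l) = inv (letter_val G a b l)"
  by (auto simp: letter_val_def flip_def Let_def)

lemma val_winv: "val (winv w) = inv (val w)"
  by (induction w) (simp_all add: winv_def val_append val_Cons letter_flip inv_mult_group)

lemma act_Nil [simp]: "act [] x = x"
  by (simp add: act_def)

lemma act_Cons: "act (l # w) x = act w (L l x)"
  by (simp add: act_def)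

lemma act_append: "act (u @ w) x = act w (act u x)"
  by (simp add: act_def)

lemma finitary_act: "finitary (act w)"
proof (induction w)
  case Nil
  then show ?case using finitary_id by (simp add: act_def id_def)
next
  case (Cons l w)
  then show ?case
    using finitary_comp[OF Cons L_finitary[of l]] by (simp add: act_def comp_def)
qed

text \<open>A nonempty word of trivial value is not reduced, and deleting a cancelling pair of
  letters changes neither its value nor its action.\<close>

lemma act_trivial: "val w = \<one> \<Longrightarrow> act w x = x"
proof (induction w arbitrary: x rule: length_induct)
  case (1 w)
  show ?case
  proof (cases "w = []")
    case False
    then have "\<not> reduced_word w"
      using free 1(2) by blast
    then obtain i where i: "Suc i < length w" "fst (w ! i) = fst (w ! Suc i)"
        "snd (w ! i) \<noteq> snd (w ! Suc i)"
      unfolding reduced_word_def by blast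
    define l u v where "l = w ! i" and "u = take i w" and "v = drop (Suc (Suc i)) w"
    have "w ! Suc i = flip l"
      using i(2,3) by (auto simp: flip_def l_def prod_eq_iff)
    then have w: "w = u @ l # flip l # v"
      using i(1) unfolding u_def v_def l_def
      by (metis Cons_nth_drop_Suc Suc_lessD append_take_drop_id)
    have "letter_val G a b l \<otimes> (inv (letter_val G a b l) \<otimes> val v) = val v"
      by (simp flip: m_assoc)
    then have "val (u @ v) = \<one>"
      using 1(2) unfolding w by (simp add: val_append val_Cons letter_flip)
    moreover have "length (u @ v) < length w"
      by (simp add: w)
    ultimately have "act (u @ v) x = x"
      using 1(1) by blast
    moreover have "L (flip l) (L l y) = y" for y
      using L_inverse[of "fst l" "snd l" y] by (simp add: flip_def)
    ultimately show ?thesis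
      by (simp add: w act_append act_Cons)
  qed simp
qed

lemma act_eq_if_val_eq:
  assumes "val u = val w"
  shows "act u x = act w x"
proof -
  \<comment> \<open>Both sides are the action of \<open>u @ winv w @ w\<close> on \<open>x\<close>:
    its last two blocks cancel, and so do its first two.\<close>
  have "act (winv w @ w) (act u x) = act u x" "act (u @ winv w) x = x"
    using assms by (intro act_trivial, simp add: val_append val_winv)+
  then show ?thesis
    by (simp add: act_append)
qed

section \<open>Left cosets of the free subgroup\<close>

definition coset :: "'g \<Rightarrow> 'g set" where "coset s = range (\<lambda>w. s \<otimes> val w)"

text \<open>The choice depends on the set \<open>coset s\<close> only, so all elements of a coset
  share one representative.\<close>

definition rep :: "'g \<Rightarrow> 'g" where "rep s = (SOME t. t \<in> coset s)"

definition word :: "'g \<Rightarrow> (bool \<times> bool) list" where "word s = (SOME w. s = rep s \<otimes> val w)"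

lemma coset_shift:
  assumes "s \<in> carrier G"
  shows "coset (s \<otimes> val w) = coset s"
proof
  have "s \<otimes> val w \<otimes> val u = s \<otimes> val (w @ u)" for u
    using assms by (simp add: val_append m_assoc)
  then show "coset (s \<otimes> val w) \<subseteq> coset s"
    unfolding coset_def by blast
  have "val w \<otimes> (inv (val w) \<otimes> val u) = val u" for u
    by (simp flip: m_assoc)
  then have "s \<otimes> val u = s \<otimes> val w \<otimes> val (winv w @ u)" for u
    using assms by (simp add: val_append val_winv m_assoc)
  then show "coset s \<subseteq> coset (s \<otimes> val w)"
    unfolding coset_def by blast
qed

lemma rep_in_coset:
  assumes "s \<in> carrier G"
  shows "rep s \<in> coset s"
proof -
  have "s \<otimes> val [] \<in> coset s"
    unfolding coset_def by blast
  then show ?thesis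
    unfolding rep_def by (rule someI)
qed

lemma rep_closed [simp]: "s \<in> carrier G \<Longrightarrow> rep s \<in> carrier G"
  using rep_in_coset[of s] by (auto simp: coset_def)

lemma rep_shift: "s \<in> carrier G \<Longrightarrow> rep (s \<otimes> val w) = rep s"
  by (simp add: rep_def coset_shift)

lemma rep_rep:
  assumes "s \<in> carrier G"
  shows "rep (rep s) = rep s"
proof -
  obtain w where "rep s = s \<otimes> val w"
    using rep_in_coset[OF assms] by (auto simp: coset_def)
  then show ?thesis
    using rep_shift[OF assms, of w] by simp
qed

lemma rep_word:
  assumes "s \<in> carrier G"
  shows "rep s \<otimes> val (word s) = s"
proof -
  obtain w where w: "rep s = s \<otimes> val w"
    using rep_in_coset[OF assms] by (auto simp: coset_def)
  have "s = rep s \<otimes> val (winv w)"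
    using assms by (simp add: w val_winv m_assoc)
  then have "s = rep s \<otimes> val (word s)"
    unfolding word_def by (rule someI)
  then show ?thesis
    by simp
qed

section \<open>The co-induced space and its action\<close>

text \<open>The co-induced space consists of the maps \<open>\<phi>\<close> from \<open>G\<close> to Cantor space with
  \<open>\<phi> (s \<otimes> val w) = act w (\<phi> s)\<close>, on which \<open>G\<close> acts by left translation of the argument.
  Such a map is determined by its values on the transversal \<open>rep ` carrier G\<close>, and countably
  many points of Cantor space are encoded in a single one.\<close>

definition index :: "('g \<times> nat) set" where "index = rep ` carrier G \<times> UNIV"

definition unpack :: "cantor \<Rightarrow> 'g \<Rightarrow> cantor" where
  "unpack z t = (\<lambda>i. z (to_nat_on index (t, i)))"

definition pack :: "('g \<Rightarrow> cantor) \<Rightarrow> cantor" where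
  "pack \<psi> = (\<lambda>m. case from_nat_into index m of (t, i) \<Rightarrow> \<psi> t i)"

lemma countable_index: "countable index"
  using countable_G by (simp add: index_def)

text \<open>The factor of natural numbers keeps the index set infinite even for a single coset, so
  that its enumeration is a bijection with the naturals.\<close>

lemma infinite_index: "infinite index"
proof -
  have "carrier G \<noteq> {}" by blast
  then show ?thesis
    by (auto simp: index_def finite_cartesian_product_iff)
qed

lemma unpack_pack: "s \<in> carrier G \<Longrightarrow> unpack (pack \<psi>) (rep s) = \<psi> (rep s)"
  by (simp add: unpack_def pack_def countable_index index_def fun_eq_iff
      from_nat_into_to_nat_on[OF countable_index, unfolded index_def])

lemma pack_unpack: "pack (unpack z) = z"
  by (simp add: unpack_def pack_def fun_eq_iff countable_index infinite_index split: prod.split)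

lemma pack_cong:
  assumes "\<And>s. s \<in> carrier G \<Longrightarrow> \<psi> (rep s) = \<psi>' (rep s)"
  shows "pack \<psi> = pack \<psi>'"
proof
  fix m
  obtain t i where "from_nat_into index m = (t, i)"
    by (cases "from_nat_into index m") blast
  moreover have "from_nat_into index m \<in> index"
    using infinite_index by (intro from_nat_into) auto
  ultimately show "pack \<psi> m = pack \<psi>' m"
    using assms by (auto simp: pack_def index_def)
qed

text \<open>The equivariant map with code \<open>z\<close>: its value at
  \<open>s = rep s \<otimes> val (word s)\<close> is forced by that at \<open>rep s\<close>.\<close>

definition extend :: "cantor \<Rightarrow> 'g \<Rightarrow> cantor" where
  "extend z s = act (word s) (unpack z (rep s))"

definition coind :: "'g \<Rightarrow> cantor \<Rightarrow> cantor" where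
  "coind g z = pack (\<lambda>t. extend z (g \<otimes> t))"

text \<open>\<open>word (s \<otimes> val w)\<close> and \<open>word s @ w\<close> may be different
  words, but they have the same value and hence, by freeness, the same action.\<close>

lemma extend_mult_val:
  assumes s: "s \<in> carrier G"
  shows "extend z (s \<otimes> val w) = act w (extend z s)"
proof -
  have "rep s \<otimes> val (word (s \<otimes> val w)) = s \<otimes> val w"
    using rep_word[of "s \<otimes> val w"] s by (simp add: rep_shift)
  also have "\<dots> = rep s \<otimes> val (word s @ w)"
    using s rep_word[OF s] by (simp add: val_append flip: m_assoc)
  finally have "val (word (s \<otimes> val w)) = val (word s @ w)"
    using s by simp
  then have "act (word (s \<otimes> val w)) x = act (word s @ w) x" for x
    by (rule act_eq_if_val_eq)
  then show ?thesis
    using s by (simp add: extend_def rep_shift act_append)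
qed

lemma extend_coind:
  assumes "g \<in> carrier G" "s \<in> carrier G"
  shows "extend (coind g z) s = extend z (g \<otimes> s)"
proof -
  have "extend (coind g z) s = act (word s) (extend z (g \<otimes> rep s))"
    using unpack_pack[OF assms(2), of "\<lambda>t. extend z (g \<otimes> t)"]
    by (simp add: extend_def[of "coind g z"] flip: coind_def)
  also have "\<dots> = extend z (g \<otimes> rep s \<otimes> val (word s))"
    using assms by (simp add: extend_mult_val)
  also have "g \<otimes> rep s \<otimes> val (word s) = g \<otimes> s"
    using assms rep_word by (simp add: m_assoc)
  finally show ?thesis .
qed

text \<open>The word chosen for a representative may be nonempty, but its value is
  \<open>\<one>\<close>.\<close>

lemma extend_rep:
  assumes "s \<in> carrier G"
  shows "extend z (rep s) = unpack z (rep s)"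
proof -
  have "rep s \<otimes> val (word (rep s)) = rep s \<otimes> \<one>"
    using rep_word[of "rep s"] assms by (simp add: rep_rep)
  then have "val (word (rep s)) = \<one>"
    using assms by simp
  then show ?thesis
    using assms by (simp add: extend_def act_trivial rep_rep)
qed

lemma finitary_unpack: "finitary (\<lambda>z. unpack z t)"
  unfolding finitary_def agree_def unpack_def by blast

lemma finitary_extend: "finitary (\<lambda>z. extend z s)"
  unfolding extend_def by (rule finitary_comp[OF finitary_act finitary_unpack])

lemma finitary_coind: "finitary (coind g)"
  unfolding finitary_def
proof
  fix m
  obtain t i where m: "from_nat_into index m = (t, i)"
    by (cases "from_nat_into index m") blast
  obtain n where "\<And>x y. agree n x y \<Longrightarrow> extend x (g \<otimes> t) i = extend y (g \<otimes> t) i"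
    using finitary_extend[of "g \<otimes> t"] unfolding finitary_def by blast
  then show "\<exists>n. \<forall>x y. agree n x y \<longrightarrow> coind g x m = coind g y m"
    unfolding coind_def pack_def m by auto
qed

lemma coind_one: "coind \<one> z = z"
proof -
  have "coind \<one> z = pack (unpack z)"
    unfolding coind_def by (rule pack_cong) (simp add: extend_rep)
  then show ?thesis
    by (simp add: pack_unpack)
qed

lemma coind_mult:
  assumes "g \<in> carrier G" "h \<in> carrier G"
  shows "coind (g \<otimes> h) z = coind h (coind g z)"
  unfolding coind_def[of "g \<otimes> h"] coind_def[of h]
  by (rule pack_cong) (simp add: assms extend_coind m_assoc)

text \<open>Evaluation at \<open>\<one>\<close> is the factor map onto the original action:
  translation by a letter moves \<open>\<one>\<close> to that letter, where equivariance
  applies.\<close>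

lemma extend_letter:
  assumes "letter_val G a b l = g"
  shows "extend (coind g z) \<one> = L l (extend z \<one>)"
proof -
  have g: "g = val [l]" "g \<in> carrier G"
    using assms letter_closed[of l] by (simp_all add: val_Cons)
  have "extend (coind g z) \<one> = extend z (\<one> \<otimes> val [l])"
    using g by (simp add: extend_coind)
  also have "\<dots> = L l (extend z \<one>)"
    by (subst extend_mult_val) (simp_all add: act_Cons)
  finally show ?thesis .
qed

text \<open>\<open>\<one>\<close> need not represent its own coset, so the value stored at the
  representative is \<open>x\<close> moved back along \<open>word \<one>\<close>.\<close>

lemma extend_one_surj: "\<exists>z. extend z \<one> = x"
proof
  let ?w = "winv (word \<one>)"
  have "act (?w @ word \<one>) x = x"
    by (rule act_trivial) (simp add: val_append val_winv)
  then show "extend (pack (\<lambda>_. act ?w x)) \<one> = x"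
    by (simp add: extend_def unpack_pack act_append)
qed

end

section \<open>The obstruction\<close>

text \<open>With \<open>f = p1 + p2\<close> and \<open>h = q1 + q2\<close> this says that \<open>h = \<rho> g f\<close> and
  \<open>f = \<rho> k ((f + h) / 2)\<close>. The detour through 0/1-valued functions makes it an open condition.\<close>

definition obstruction ::
  "('g, 'm) monoid_scheme \<Rightarrow> CK \<Rightarrow> CK \<Rightarrow> CK \<Rightarrow> CK \<Rightarrow> CK \<Rightarrow> CK \<Rightarrow> 'g \<Rightarrow> 'g \<Rightarrow> bool" where
  "obstruction G p1 p2 q1 q2 r1 r2 g k \<longleftrightarrow>
     g \<in> carrier G \<and> k \<in> carrier G \<and>
     zero_one p1 \<and> zero_one p2 \<and> zero_one q1 \<and> zero_one q2 \<and> zero_one r1 \<and> zero_one r2 \<and>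
     p1 + p2 \<noteq> q1 + q2 \<and> (p1 + p2) + (q1 + q2) = 2 *\<^sub>R (r1 + r2)"

definition obstructed :: "('g, 'm) monoid_scheme \<Rightarrow> ('g \<Rightarrow> CK \<Rightarrow> CK) set" where
  "obstructed G = {\<rho> \<in> Act_set G. \<exists>p1 p2 q1 q2 r1 r2 g k. obstruction G p1 p2 q1 q2 r1 r2 g k \<and>
     \<rho> g p1 = q1 \<and> \<rho> g p2 = q2 \<and> \<rho> k r1 = p1 \<and> \<rho> k r2 = p2}"

lemma obstructed_no_norm:
  assumes G: "group G" and \<rho>: "\<rho> \<in> obstructed G"
    and inv: "invariant_norm G \<rho> N" and strict: "strictly_convex_norm N"
  shows False
proof -
  obtain p1 p2 q1 q2 r1 r2 g k where gk: "g \<in> carrier G" "k \<in> carrier G"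
    and neq: "p1 + p2 \<noteq> q1 + q2" and mid: "(p1 + p2) + (q1 + q2) = 2 *\<^sub>R (r1 + r2)"
    and eq: "\<rho> g p1 = q1" "\<rho> g p2 = q2" "\<rho> k r1 = p1" "\<rho> k r2 = p2"
    using \<rho> unfolding obstructed_def obstruction_def by blast
  have "linear (\<rho> g)" "linear (\<rho> k)"
    using \<rho> gk by (auto simp: obstructed_def intro!: LIsoD(1) Act_set_LIso[OF G])
  then have "\<rho> g (p1 + p2) = q1 + q2" "\<rho> k (r1 + r2) = p1 + p2"
    using eq by (simp_all add: linear_add)
  then have "N (p1 + p2) = N (q1 + q2)" "N (r1 + r2) = N (p1 + p2)"
    using inv gk unfolding invariant_norm_def by metis+
  moreover have "(1/2) *\<^sub>R ((p1 + p2) + (q1 + q2)) = r1 + r2"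
    by (simp add: mid)
  ultimately show False
    using strict neq unfolding strictly_convex_norm_def by (metis less_irrefl)
qed

section \<open>Openness of the obstruction\<close>

lemma topspace_Act_top: "topspace (Act_top G) = Act_set G"
  by (auto simp: Act_top_def SOT_LIso_def Act_set_def)

lemma openin_Act_close:
  assumes "g \<in> carrier G"
  shows "openin (Act_top G) {\<rho> \<in> Act_set G. norm (\<rho> g p - q) < 1}"
proof -
  have "continuous_map SOT_LIso euclidean (\<lambda>T. T p)"
    unfolding SOT_LIso_def
    by (intro continuous_map_from_subtopology continuous_map_product_projection UNIV_I)
  moreover have "continuous_map (Act_top G) SOT_LIso (\<lambda>\<rho>. \<rho> g)"
    unfolding Act_top_def using assms
    by (intro continuous_map_from_subtopology continuous_map_product_projection)
  ultimately have "continuous_map (Act_top G) euclidean (\<lambda>\<rho>. \<rho> g p)"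
    using continuous_map_compose[of "Act_top G" SOT_LIso "\<lambda>\<rho>. \<rho> g" euclidean "\<lambda>T. T p"]
    by (simp add: comp_def)
  then have "openin (Act_top G) {\<rho> \<in> topspace (Act_top G). \<rho> g p \<in> ball q 1}"
    by (rule openin_continuous_map_preimage) (simp add: open_openin[symmetric])
  then show ?thesis
    by (simp add: topspace_Act_top dist_norm norm_minus_commute)
qed

text \<open>The witnesses stay fixed. Actions send them to 0/1-valued functions, so each of the four
  equations follows from a distance less than 1.\<close>

lemma openin_obstructed:
  assumes G: "group G"
  shows "openin (Act_top G) (obstructed G)"
proof -
  let ?U = "\<lambda>g p q. {\<rho> \<in> Act_set G. norm (\<rho> g p - q) < 1}"
  have eq: "\<rho> g p = q" if "\<rho> \<in> ?U g p q" "g \<in> carrier G" "zero_one p" "zero_one q" for \<rho> g p q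
    using that Act_set_zero_one[OF G] by (intro zero_one_eq_if_close) auto
  have "\<exists>T. openin (Act_top G) T \<and> \<rho> \<in> T \<and> T \<subseteq> obstructed G" if \<rho>: "\<rho> \<in> obstructed G" for \<rho>
  proof -
    obtain p1 p2 q1 q2 r1 r2 g k where ob: "obstruction G p1 p2 q1 q2 r1 r2 g k"
      and e: "\<rho> g p1 = q1" "\<rho> g p2 = q2" "\<rho> k r1 = p1" "\<rho> k r2 = p2"
      using \<rho> unfolding obstructed_def by blast
    note ob' = ob[unfolded obstruction_def]
    let ?T = "?U g p1 q1 \<inter> ?U g p2 q2 \<inter> ?U k r1 p1 \<inter> ?U k r2 p2"
    have "\<sigma> \<in> obstructed G" if "\<sigma> \<in> ?T" for \<sigma>
    proof -
      have "\<sigma> g p1 = q1" "\<sigma> g p2 = q2" "\<sigma> k r1 = p1" "\<sigma> k r2 = p2"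
        using eq[of \<sigma> g p1 q1] eq[of \<sigma> g p2 q2] eq[of \<sigma> k r1 p1] eq[of \<sigma> k r2 p2] that ob'
        by simp_all
      then show ?thesis
        using ob that by (auto simp: obstructed_def)
    qed
    moreover have "openin (Act_top G) ?T"
      using ob' by (intro openin_Int openin_Act_close) simp_all
    moreover have "\<rho> \<in> ?T"
      using \<rho> e by (simp add: obstructed_def)
    ultimately show ?thesis
      by blast
  qed
  then show ?thesis
    by (subst openin_subopen) blast
qed

section \<open>Density of the obstruction\<close>

text \<open>Two piecewise shifts of Cantor space: \<open>shiftA\<close> maps
  \<open>00w \<mapsto> 0w\<close>, \<open>01w \<mapsto> 100w\<close>, \<open>10w \<mapsto> 101w\<close>, \<open>11w \<mapsto> 11w\<close>, and \<open>shiftB\<close> maps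
  \<open>0w \<mapsto> 00w\<close>, \<open>10w \<mapsto> 10w\<close>, \<open>110w \<mapsto> 01w\<close>, \<open>111w \<mapsto> 11w\<close>.
  Let \<open>f\<close> take the values 0, 0, 2, 1 and \<open>h\<close> the values 0, 2, 2, 1 on the cylinders
  00, 01, 10, 11. Then \<open>h = f \<circ> shiftA\<close> and \<open>f = (f + h) / 2 \<circ> shiftB\<close>.\<close>

definition shiftA :: "cantor \<Rightarrow> cantor" where
  "shiftA z = (if z 0 = z 1 then (if z 0 then z else (\<lambda>i. z (i + 1)))
     else (\<lambda>i. if i = 0 then True else if i = 1 then False else if i = 2 then z 0 else z (i - 1)))"

definition shiftA_inv :: "cantor \<Rightarrow> cantor" where
  "shiftA_inv z = (if \<not> z 0 then (\<lambda>i. if i = 0 then False else z (i - 1)) else if z 1 then z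
     else (\<lambda>i. if i = 0 then z 2 else if i = 1 then \<not> z 2 else z (i + 1)))"

definition shiftB :: "cantor \<Rightarrow> cantor" where
  "shiftB z = (if \<not> z 0 then (\<lambda>i. if i = 0 then False else z (i - 1)) else if \<not> z 1 then z
     else (\<lambda>i. if i = 0 then z 2 else if i = 1 then True else z (i + 1)))"

definition shiftB_inv :: "cantor \<Rightarrow> cantor" where
  "shiftB_inv z = (if z 1 then (\<lambda>i. if i = 0 then True else if i = 1 then True
       else if i = 2 then z 0 else z (i - 1))
     else if z 0 then z else (\<lambda>i. z (i + 1)))"

definition shift :: "bool \<times> bool \<Rightarrow> cantor \<Rightarrow> cantor" where
  "shift l = (if fst l then (if snd l then shiftA_inv else shiftA)
     else (if snd l then shiftB_inv else shiftB))"

lemma shiftA_inverse: "shiftA_inv (shiftA z) = z" "shiftA (shiftA_inv z) = z"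
  by (auto simp: shiftA_def shiftA_inv_def fun_eq_iff numeral_2_eq_2)

lemma shiftB_inverse: "shiftB_inv (shiftB z) = z" "shiftB (shiftB_inv z) = z"
  by (auto simp: shiftB_def shiftB_inv_def fun_eq_iff numeral_2_eq_2)

lemma shift_inverse: "shift (x, \<not> s) (shift (x, s) z) = z"
  by (simp add: shift_def shiftA_inverse shiftB_inverse)

lemma finitary_shift: "finitary (shift l)"
proof -
  have "shift l x i = shift l y i" if "agree (i + 3) x y" for i x y
    using that by (simp add: agree_def shift_def shiftA_def shiftA_inv_def shiftB_def shiftB_inv_def)
  then show ?thesis
    unfolding finitary_def by blast
qed

definition ind :: "(cantor \<Rightarrow> bool) \<Rightarrow> cantor \<Rightarrow> real" where
  "ind P z = of_bool (P z)"

lemma cylinder_continuous_ind: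
  assumes "\<And>x y. agree 2 x y \<Longrightarrow> P x = P y"
  shows "cylinder_continuous (ind P)"
  unfolding cylinder_continuous_def
proof (intro allI impI exI)
  fix e :: real and x y assume "e > 0" "agree 2 x y"
  then show "dist (ind P x) (ind P y) < e"
    using assms[of x y] by (simp add: ind_def)
qed

text \<open>\<open>\<epsilon>\<close> is evaluation of the extended map at \<open>\<one>\<close>,
  and \<open>g\<close>, \<open>k\<close> are the free generators.\<close>

lemma ex_coind_action:
  assumes "group G" "countable (carrier G)" "contains_free_group_2 G"
  obtains R g k \<epsilon> where "right_action G R" "g \<in> carrier G" "k \<in> carrier G" "finitary \<epsilon>" "surj \<epsilon>"
    "\<And>z. \<epsilon> (R g z) = shiftA (\<epsilon> z)" "\<And>z. \<epsilon> (R k z) = shiftB (\<epsilon> z)"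
proof -
  obtain a b where ab: "a \<in> carrier G" "b \<in> carrier G"
    "\<And>w. w \<noteq> [] \<Longrightarrow> reduced_word w \<Longrightarrow> word_val G a b w \<noteq> \<one>\<^bsub>G\<^esub>"
    using assms(3) unfolding contains_free_group_2_def by blast
  interpret group G by fact
  interpret free_pair G a b shift
    by unfold_locales (use ab assms in \<open>auto simp: shift_inverse finitary_shift\<close>)
  have "right_action G coind"
    by unfold_locales (simp_all add: finitary_coind coind_one coind_mult)
  moreover have "surj (\<lambda>z. extend z \<one>\<^bsub>G\<^esub>)"
    unfolding surj_def using extend_one_surj by metis
  moreover have "extend (coind a z) \<one>\<^bsub>G\<^esub> = shiftA (extend z \<one>\<^bsub>G\<^esub>)" for z
    using extend_letter[of "(True, False)" a z] by (simp add: letter_val_def shift_def)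
  moreover have "extend (coind b z) \<one>\<^bsub>G\<^esub> = shiftB (extend z \<one>\<^bsub>G\<^esub>)" for z
    using extend_letter[of "(False, False)" b z] by (simp add: letter_val_def shift_def)
  ultimately show thesis
    using that ab finitary_extend by blast
qed

lemma ex_obstructed_limit:
  assumes G: "group G" "countable (carrier G)" "contains_free_group_2 G" and \<rho>: "\<rho> \<in> Act_set G"
  shows "\<exists>\<sigma>. range \<sigma> \<subseteq> obstructed G \<and> limitin (Act_top G) \<sigma> \<rho> sequentially"
proof -
  obtain R g k \<epsilon> where R: "right_action G R" and gk: "g \<in> carrier G" "k \<in> carrier G"
    and \<epsilon>: "finitary \<epsilon>" "surj \<epsilon>"
      "\<And>z. \<epsilon> (R g z) = shiftA (\<epsilon> z)" "\<And>z. \<epsilon> (R k z) = shiftB (\<epsilon> z)"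
    using ex_coind_action[OF G] by blast
  interpret right_action G R by (rule R)
  have "twist_action G n \<rho> R \<in> obstructed G" for n
  proof -
    let ?\<sigma> = "twist_action G n \<rho> R"
    \<comment> \<open>Indicators pulled back through the second factor and
      \<open>\<epsilon>\<close>; on these the twisted action does not depend on
      \<open>\<rho>\<close>.\<close>
    define F where "F P = (Bcontfun (\<lambda>z. ind P (\<epsilon> (csnd n z))) :: CK)" for P
    have F: "apply_bcontfun (F P) z = of_bool (P (\<epsilon> (csnd n z)))"
      if "\<And>x y. agree 2 x y \<Longrightarrow> P x = P y" for P z
    proof -
      have "cylinder_continuous (\<lambda>z. ind P (\<epsilon> (csnd n z)))"
        by (rule cylinder_continuous_comp[OF cylinder_continuous_ind finitary_comp[OF \<epsilon>(1) finitary_csnd]])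
          (rule that)
      then show ?thesis
        unfolding F_def by (simp add: apply_Bcontfun_cylinder_continuous ind_def)
    qed
    have \<sigma>: "?\<sigma> s (F P) = F Q"
      if s: "s \<in> carrier G" and P: "\<And>x y. agree 2 x y \<Longrightarrow> P x = P y"
        and Q: "\<And>z. P (\<epsilon> (R s z)) = Q (\<epsilon> z)" for s P Q
    proof -
      have "cylinder_continuous (\<lambda>z. ind P (\<epsilon> z))"
        by (rule cylinder_continuous_comp[OF cylinder_continuous_ind \<epsilon>(1)]) (rule P)
      from twist_comp_csnd[OF Act_set_LIso[OF G(1) \<rho> s] R_finitary[OF s] this, where n = n]
      show ?thesis
        using s Q by (simp add: F_def twist_action_def ind_def)
    qed
    \<comment> \<open>Level sets of \<open>f\<close>, \<open>h\<close> and their midpoint, whose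
      values are 0, 1, 2, 1: the digit 1 marks where the value is at least 1, the digit 2 where it
      is 2.\<close>
    define p1 p2 q1 q2 r1 r2 :: "cantor \<Rightarrow> bool" where
      "p1 = (\<lambda>z. z 0)" and "p2 = (\<lambda>z. z 0 \<and> \<not> z 1)" and
      "q1 = (\<lambda>z. z 0 \<or> z 1)" and "q2 = (\<lambda>z. z 0 \<noteq> z 1)" and
      "r1 = (\<lambda>z. z 0 \<or> z 1)" and "r2 = (\<lambda>z. z 0 \<and> \<not> z 1)"
    note defs = p1_def p2_def q1_def q2_def r1_def r2_def
    have ag: "P x = P y" if "agree 2 x y" "P \<in> {p1, p2, q1, q2, r1, r2}" for P x y
      using that by (auto simp: defs agree_def numeral_2_eq_2)
    have Fs: "F P z = of_bool (P (\<epsilon> (csnd n z)))" if "P \<in> {p1, p2, q1, q2, r1, r2}" for P z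
      using F ag that by blast
    have "zero_one (F P)" if "P \<in> {p1, p2, q1, q2, r1, r2}" for P
      using Fs[OF that] by (simp add: zero_one_def)
    moreover have "(F p1 + F p2) + (F q1 + F q2) = 2 *\<^sub>R (F r1 + F r2)"
      by (rule bcontfun_eqI) (auto simp: Fs, auto simp: defs)
    moreover have "F p1 + F p2 \<noteq> F q1 + F q2"
    proof -
      \<comment> \<open>On the cylinder 01, \<open>f\<close> is 0 and \<open>h\<close> is 2;
        surjectivity of \<open>\<epsilon>\<close> provides a point over it.\<close>
      obtain y where y: "\<epsilon> y = (\<lambda>i. i = 1)"
        using \<epsilon>(2) by (metis surjD)
      have "(F p1 + F p2) (cpair n y y) \<noteq> (F q1 + F q2) (cpair n y y)"
        by (simp add: Fs) (simp add: defs y)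
      then show ?thesis by metis
    qed
    ultimately have "obstruction G (F p1) (F p2) (F q1) (F q2) (F r1) (F r2) g k"
      using gk by (simp add: obstruction_def)
    moreover have "?\<sigma> g (F p1) = F q1" "?\<sigma> g (F p2) = F q2" "?\<sigma> k (F r1) = F p1" "?\<sigma> k (F r2) = F p2"
      by (rule \<sigma>; (use gk ag in blast)?; simp add: defs \<epsilon> shiftA_def shiftB_def)+
    ultimately show ?thesis
      using twist_action_in_Act_set[OF \<rho>] unfolding obstructed_def by blast
  qed
  then show ?thesis
    using twist_action_limitin[OF \<rho>] by (intro exI[of _ "\<lambda>n. twist_action G n \<rho> R"]) auto
qed

section \<open>Comeagerness\<close>

lemma nowhere_dense_inI:
  assumes "openin Y U" "A \<subseteq> topspace Y - U" "Y closure_of U = topspace Y"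
  shows "nowhere_dense_in Y A"
proof -
  have "Y closure_of A \<subseteq> topspace Y - U"
    using assms(1,2) by (intro closure_of_minimal) auto
  then have "Y interior_of (Y closure_of A) \<subseteq> Y interior_of (topspace Y - U)"
    by (rule interior_of_mono)
  also have "\<dots> = {}"
    using assms(3) by (simp add: interior_of_complement)
  finally show ?thesis
    using assms(2) by (auto simp: nowhere_dense_in_def)
qed

theorem theorem6p5:
  fixes G :: "('g, 'm) monoid_scheme"
  assumes "group G" and "countable (carrier G)" and "contains_free_group_2 G"
  shows "comeager_in (Act_top G)
           {\<rho> \<in> Act_set G. \<not> (\<exists>N. equivalent_norm N \<and> invariant_norm G \<rho> N \<and> strictly_convex_norm N)}"
    (is "comeager_in ?Y ?D")
proof -
  have "obstructed G \<subseteq> ?D"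
  proof
    fix \<rho> assume "\<rho> \<in> obstructed G"
    moreover from this have "\<rho> \<in> Act_set G"
      by (simp add: obstructed_def)
    ultimately show "\<rho> \<in> ?D"
      using obstructed_no_norm[OF assms(1)] by blast
  qed
  moreover have "?Y closure_of obstructed G = topspace ?Y"
  proof (intro equalityI closure_of_subset_topspace subsetI)
    fix \<rho> assume \<rho>: "\<rho> \<in> topspace ?Y"
    then obtain \<sigma> where \<sigma>: "range \<sigma> \<subseteq> obstructed G" "limitin ?Y \<sigma> \<rho> sequentially"
      using ex_obstructed_limit[OF assms, of \<rho>] unfolding topspace_Act_top by blast
    have "\<exists>y\<in>obstructed G. y \<in> W" if "openin ?Y W" "\<rho> \<in> W" for W
    proof -
      have "\<forall>\<^sub>F n in sequentially. \<sigma> n \<in> W"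
        using \<sigma>(2) that by (simp add: limitin_def)
      then obtain n where "\<sigma> n \<in> W"
        using eventually_happens'[OF sequentially_bot] by blast
      then show ?thesis
        using \<sigma>(1) by blast
    qed
    then show "\<rho> \<in> ?Y closure_of obstructed G"
      using \<rho> by (auto simp: in_closure_of)
  qed
  ultimately have "nowhere_dense_in ?Y (topspace ?Y - ?D)"
    using openin_obstructed[OF assms(1)] by (intro nowhere_dense_inI[of _ "obstructed G"]) auto
  \<comment> \<open>The complement is itself nowhere dense, so a constant sequence shows it
    meager.\<close>
  then have "meager_in ?Y (topspace ?Y - ?D)"
    unfolding meager_in_def by (intro exI[of _ "\<lambda>_. topspace ?Y - ?D"]) simp
  then show ?thesis
    by (simp add: comeager_in_def topspace_Act_top)
qed

end
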